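(* Let $(p_i)_{i=1}^{n}$ be reals in $[0,1]$, let $(Y_i)_{i=1}^{n}$ be independent random variables with $Y_i \sim \mathrm{Bernoulli}(p_i)$, and let $Y=\sum_{i=1}^{n}Y_i$. Denote $\lambda=\sum_{i=1}^{n} p_i$ and let $X(\lambda)$ be a Poisson random variable with mean $\lambda$. Then for integers $k\ge 2$ with $k =o\big(\lambda/\max\{1,\sum_{i=1}^{n}p_i^2\}\big)$, \[ \mathbb{E}(Y-\lambda)^k \sim \mathbb{E} (X(\lambda)-\lambda)^k;\] that is, for any sequence of such data $(n,(p_i),k)$ with $k\ge 2$ and $k\max\{1,\sum_i p_i^2\}/\lambda\to 0$, the ratio $\mathbb{E}(Y-\lambda)^k / \mathbb{E}(X(\lambda)-\lambda)^k$ tends to $1$. *)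

theory Defs
  imports "HOL-Probability.Probability"
begin

definition bernoulli_rv :: "'a measure \<Rightarrow> real \<Rightarrow> ('a \<Rightarrow> real) \<Rightarrow> bool" where
  "bernoulli_rv M p Y \<longleftrightarrow>
     Y \<in> borel_measurable M \<and>
     distr M borel Y = distr (measure_pmf (bernoulli_pmf p)) borel of_bool"

(* The library specifies poisson_pmf only for positive rates; mean 0 is the point mass at 0. *)
definition poisson_rv :: "'a measure \<Rightarrow> real \<Rightarrow> ('a \<Rightarrow> real) \<Rightarrow> bool" where
  "poisson_rv M r X \<longleftrightarrow>
     X \<in> borel_measurable M \<and>
     distr M borel X =
       distr (measure_pmf (if r = 0 then return_pmf 0 else poisson_pmf r)) borel of_nat"

end

theory Submission
  imports Defs
begin

text \<open>Divided by factorials, the central moments of independent summands multiply as formal power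
  series in \<open>z\<close>. With \<open>w = e\<^sup>z - 1\<close>, the series of a Bernoulli variable is
  \<open>(1 + p w) e\<^sup>-\<^sup>p\<^sup>z\<close> and that of a Poisson variable is \<open>P\<^sub>\<lambda> = exp (\<lambda> (w - z))\<close>, so the series of
  \<open>Y - \<lambda>\<close> is \<open>P\<^sub>\<lambda>\<close> times the product of the factors \<open>F\<^sub>i = (1 + p\<^sub>i w) exp (- p\<^sub>i w)\<close>.
  The factor \<open>F\<^sub>i\<close> has coefficients \<open>1, 0\<close> and then \<open>O(p\<^sub>i\<^sup>2)\<close>.
  The coefficients \<open>a\<^sub>k\<close> of \<open>P\<^sub>\<lambda>\<close> are nonnegative and satisfy, from \<open>P\<^sub>\<lambda>' = \<lambda> w P\<^sub>\<lambda>\<close>, the bound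
  \<open>a\<^sub>k\<^sub>-\<^sub>2 \<le> (k / \<lambda>) a\<^sub>k\<close>; hence passing from \<open>k\<close> to \<open>k - j\<close> costs a factor
  \<open>\<epsilon>\<^bsup>\<lfloor>j/2\<rfloor>\<^esup>\<close>, up to a factor 2, with \<open>\<epsilon> = k / \<lambda>\<close>. The coefficient norm with these weights is
  submultiplicative because \<open>\<lfloor>i/2\<rfloor> + \<lfloor>j/2\<rfloor> \<le> \<lfloor>(i+j)/2\<rfloor>\<close>, so the product of the \<open>F\<^sub>i\<close>
  differs from 1 by at most \<open>exp (8 \<epsilon> \<Sum> p\<^sub>i\<^sup>2) - 1\<close>, which tends to 0.\<close>

unbundle no vec_syntax and fps_syntax

section \<open>The power series of the centred Poisson law\<close>

text \<open>This is exp (c (e^z - 1 - z)); the composition is meaningful because the inner series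
  has no constant term. Negative \<open>c\<close> is allowed, so that
  \<open>poisson_fps (- c)\<close> inverts \<open>poisson_fps c\<close>.\<close>

definition poisson_fps :: "real \<Rightarrow> real fps" where
  "poisson_fps c = fps_exp c oo (fps_exp 1 - 1 - fps_X)"

lemma poisson_fps_nth_0 [simp]: "poisson_fps c $ 0 = 1"
  by (simp add: poisson_fps_def fps_compose_nth)

lemma poisson_fps_0 [simp]: "poisson_fps 0 = 1"
  by (simp add: poisson_fps_def)

lemma poisson_fps_add: "poisson_fps (c + d) = poisson_fps c * poisson_fps d"
  unfolding poisson_fps_def fps_exp_add_mult by (rule fps_compose_mult_distrib) simp

lemma poisson_fps_sum: "finite I \<Longrightarrow> poisson_fps (sum c I) = (\<Prod>i\<in>I. poisson_fps (c i))"
  by (induction I rule: finite_induct) (simp_all add: poisson_fps_add)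

lemma poisson_fps_deriv:
  "fps_deriv (poisson_fps c) = fps_const c * (fps_exp 1 - 1) * poisson_fps c"
  unfolding poisson_fps_def
  by (subst fps_compose_deriv) (simp_all add: fps_const_mult_apply_left mult_ac)

text \<open>Multiplying a solution by the inverse series \<open>poisson_fps (- c)\<close> gives zero
  derivative, hence a constant. This later identifies the moment series of a Poisson
  variable.\<close>

lemma poisson_fps_unique:
  assumes "fps_deriv F = fps_const c * (fps_exp 1 - 1) * F" and "F $ 0 = 1"
  shows "F = poisson_fps c"
proof -
  have "fps_deriv (F * poisson_fps (- c)) = 0"
    by (simp add: assms(1) poisson_fps_deriv algebra_simps flip: fps_const_neg)
  then have "F * poisson_fps (- c) = 1"
    unfolding fps_deriv_eq_0_iff by (simp add: assms(2))
  then have "F * poisson_fps (- c) * poisson_fps c = poisson_fps c"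
    by simp
  moreover have "poisson_fps (- c) * poisson_fps c = 1"
    by (simp flip: poisson_fps_add)
  ultimately show ?thesis
    by (simp add: mult.assoc)
qed

text \<open>Coefficient \<open>k\<close> of the differential equation; the sum stops before
  \<open>j = k\<close> because \<open>fps_exp 1 - 1\<close> has no constant term.\<close>

lemma poisson_fps_nth_Suc:
  "real (Suc k) * poisson_fps c $ Suc k = c * (\<Sum>j<k. poisson_fps c $ j / fact (k - j))"
proof -
  have "real (Suc k) * poisson_fps c $ Suc k = fps_deriv (poisson_fps c) $ k"
    by (simp add: algebra_simps)
  also have "\<dots> = c * (\<Sum>j\<le>k. poisson_fps c $ j * (1 / fact (k - j) - (if k - j = 0 then 1 else 0)))"
    unfolding poisson_fps_deriv mult.assoc fps_mult_left_const_nth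
    by (subst mult.commute[of "fps_exp 1 - 1"], subst fps_mult_nth) (simp add: atMost_atLeast0)
  also have "(\<Sum>j\<le>k. poisson_fps c $ j * (1 / fact (k - j) - (if k - j = 0 then 1 else 0))) =
      (\<Sum>j<k. poisson_fps c $ j / fact (k - j))"
    by (simp add: lessThan_Suc_atMost[symmetric])
  finally show ?thesis .
qed

lemma poisson_fps_nonneg: "c \<ge> 0 \<Longrightarrow> poisson_fps c $ k \<ge> 0"
proof (induction k rule: less_induct)
  case (less k)
  show ?case
  proof (cases k)
    case (Suc j)
    then have "0 \<le> real (Suc j) * poisson_fps c $ Suc j"
      unfolding poisson_fps_nth_Suc using less by (auto intro!: mult_nonneg_nonneg sum_nonneg)
    then show ?thesis
      using Suc by (simp add: zero_le_mult_iff del: of_nat_Suc)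
  qed simp
qed

text \<open>A single term of the recurrence is at most the whole sum, all terms being
  nonnegative.\<close>

lemma poisson_fps_nth_le:
  assumes "c \<ge> 0" and "j < k"
  shows "c * poisson_fps c $ j / fact (k - j) \<le> real (Suc k) * poisson_fps c $ Suc k"
proof -
  have "poisson_fps c $ j / fact (k - j) \<le> (\<Sum>j<k. poisson_fps c $ j / fact (k - j))"
    using assms by (intro member_le_sum) (auto simp: poisson_fps_nonneg)
  then show ?thesis
    unfolding poisson_fps_nth_Suc using assms(1) mult_left_mono by fastforce
qed

text \<open>The term \<open>j = 0\<close> of the recurrence is already positive; it occurs only from
  \<open>k = 2\<close> on.\<close>

lemma poisson_fps_pos:
  assumes "c > 0" and "k \<ge> 2"
  shows "poisson_fps c $ k > 0"
proof -
  from assms(2) obtain m where k: "k = Suc m" "0 < m"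
    by (cases k) auto
  have "0 < c * poisson_fps c $ 0 / fact (m - 0)"
    using assms(1) by simp
  also have "\<dots> \<le> real (Suc m) * poisson_fps c $ Suc m"
    using assms(1) k(2) by (intro poisson_fps_nth_le) auto
  finally show ?thesis
    by (simp add: k zero_less_mult_iff del: of_nat_Suc)
qed

text \<open>The case \<open>j = 1\<close> fails for \<open>k = 1\<close>, since \<open>a\<^sub>1 = 0\<close>; the factor 2 is needed for \<open>j = 3\<close>.\<close>
lemma poisson_fps_nth_diff_le:
  assumes "c > 0" and "real k \<le> e * c" and "j \<le> k" and "j \<noteq> 1"
  shows "poisson_fps c $ (k - j) \<le> 2 * e ^ (j div 2) * poisson_fps c $ k"
  using assms(3,4)
proof (induction j rule: less_induct)
  case (less j)
  \<comment> \<open>One term of the recurrence, with the factor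
    \<open>Suc l \<le> k \<le> e * c\<close> absorbed into \<open>e\<close>.\<close>
  have step: "poisson_fps c $ i / fact (l - i) \<le> e * poisson_fps c $ Suc l" if "i < l" "l < k" for i l
  proof -
    have "c * (poisson_fps c $ i / fact (l - i)) \<le> real (Suc l) * poisson_fps c $ Suc l"
      using poisson_fps_nth_le[of c i l] assms(1) that by simp
    also have "\<dots> \<le> (e * c) * poisson_fps c $ Suc l"
      using assms that by (intro mult_right_mono poisson_fps_nonneg) auto
    finally have "c * (poisson_fps c $ i / fact (l - i)) \<le> c * (e * poisson_fps c $ Suc l)"
      by (simp add: mult_ac)
    then show ?thesis
      using assms(1) by (simp only: mult_le_cancel_left_pos)
  qed
  have e: "e \<ge> 0"
    using assms(1,2) of_nat_0_le_iff[of k, where 'a = real] by (metis order_trans zero_le_mult_iff not_le)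
  consider "j = 0" | "j = 3" | "j \<ge> 2" "j \<noteq> 3"
    using less.prems by linarith
  then show ?case
  proof cases
    case 1
    then show ?thesis
      using assms(1) by (simp add: poisson_fps_nonneg)
  next
    \<comment> \<open>Dropping by 2 first would leave the excluded \<open>j = 1\<close>; a single
      drop by 3 costs \<open>fact 2\<close>, whence the factor 2.\<close>
    case 2
    with less.prems obtain m where "k = m + 3"
      by (metis le_add_diff_inverse2)
    with 2 step[of m "m + 2"] show ?thesis
      by (simp add: numeral_3_eq_3 fact_2 algebra_simps)
  next
    case 3
    \<comment> \<open>The drop by 2 from \<open>k - i\<close> to \<open>k - j\<close> costs only
      \<open>e\<close>, its factorial being \<open>fact 1\<close>; \<open>j \<noteq> 3\<close>
      ensures \<open>i \<noteq> 1\<close> for the induction hypothesis.\<close>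
    define i where "i = j - 2"
    define l where "l = k - j"
    have i: "j = i + 2" "i < j" "i \<noteq> 1" "k = l + (i + 2)"
      using 3 less.prems by (auto simp: i_def l_def)
    have "poisson_fps c $ (k - j) \<le> e * poisson_fps c $ (k - i)"
      using step[of l "Suc l"] i(1,4) by simp
    also have "\<dots> \<le> e * (2 * e ^ (i div 2) * poisson_fps c $ k)"
      using e less.IH[of i] i by (intro mult_left_mono) auto
    finally show ?thesis
      by (simp add: i(1) mult_ac)
  qed
qed

section \<open>A submultiplicative norm on coefficients\<close>

text \<open>Cut off at \<open>k\<close> because later coefficients of a factor do not affect
  coefficient \<open>k\<close> of a product.\<close>

definition weighted_norm :: "real \<Rightarrow> nat \<Rightarrow> real fps \<Rightarrow> real" where
  "weighted_norm e k F = (\<Sum>j\<le>k. \<bar>F $ j\<bar> * e ^ (j div 2))"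

lemma weighted_norm_nonneg: "e \<ge> 0 \<Longrightarrow> weighted_norm e k F \<ge> 0"
  by (simp add: weighted_norm_def sum_nonneg)

lemma weighted_norm_one [simp]: "weighted_norm e k 1 = 1"
  unfolding weighted_norm_def
  by (subst sum.mono_neutral_cong_right[where S = "{0}" and h = "\<lambda>_. 1"]) auto

text \<open>For \<open>e \<le> 1\<close> the weight of \<open>j\<close> is at most the product of
  the weights of \<open>i\<close> and \<open>j - i\<close>. The resulting sum over the triangle
  \<open>i + j \<le> k\<close> is then enlarged to the full square.\<close>

lemma weighted_norm_mult:
  assumes "0 \<le> e" "e \<le> 1"
  shows "weighted_norm e k (F * G) \<le> weighted_norm e k F * weighted_norm e k G"
proof -
  let ?f = "\<lambda>j. \<bar>F $ j\<bar> * e ^ (j div 2)" and ?g = "\<lambda>j. \<bar>G $ j\<bar> * e ^ (j div 2)"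
  have "\<bar>(F * G) $ j\<bar> * e ^ (j div 2) \<le> (\<Sum>i\<le>j. ?f i * ?g (j - i))" for j
  proof -
    have "\<bar>(F * G) $ j\<bar> * e ^ (j div 2) \<le> (\<Sum>i\<le>j. \<bar>F $ i * G $ (j - i)\<bar>) * e ^ (j div 2)"
      unfolding fps_mult_nth atMost_atLeast0 using assms by (intro mult_right_mono sum_abs) auto
    also have "\<dots> \<le> (\<Sum>i\<le>j. ?f i * ?g (j - i))"
      unfolding sum_distrib_right
    proof (rule sum_mono)
      fix i assume "i \<in> {..j}"
      then have "i div 2 + (j - i) div 2 \<le> j div 2"
        by simp
      then have "e ^ (j div 2) \<le> e ^ (i div 2) * e ^ ((j - i) div 2)"
        unfolding power_add[symmetric] using assms by (rule power_decreasing)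
      then have "\<bar>F $ i * G $ (j - i)\<bar> * e ^ (j div 2)
          \<le> \<bar>F $ i * G $ (j - i)\<bar> * (e ^ (i div 2) * e ^ ((j - i) div 2))"
        by (rule mult_left_mono) simp
      then show "\<bar>F $ i * G $ (j - i)\<bar> * e ^ (j div 2) \<le> ?f i * ?g (j - i)"
        by (simp add: abs_mult mult_ac)
    qed
    finally show ?thesis .
  qed
  then have "weighted_norm e k (F * G) \<le> (\<Sum>j\<le>k. \<Sum>i\<le>j. ?f i * ?g (j - i))"
    unfolding weighted_norm_def by (rule sum_mono)
  also have "\<dots> = (\<Sum>(i, j)\<in>{(i, j). i + j \<le> k}. ?f i * ?g j)"
    by (rule sum.triangle_reindex_eq[symmetric])
  also have "\<dots> \<le> (\<Sum>(i, j)\<in>{..k} \<times> {..k}. ?f i * ?g j)"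
    using assms by (intro sum_mono2) auto
  also have "\<dots> = weighted_norm e k F * weighted_norm e k G"
    by (simp add: weighted_norm_def sum_product sum.cartesian_product)
  finally show ?thesis .
qed

lemma weighted_norm_prod:
  assumes "0 \<le> e" "e \<le> 1"
  shows "weighted_norm e k (\<Prod>i\<in>I. F i) \<le> (\<Prod>i\<in>I. weighted_norm e k (F i))"
proof (induction I rule: infinite_finite_induct)
  case (insert i I)
  have "weighted_norm e k (F i * (\<Prod>i\<in>I. F i)) \<le> weighted_norm e k (F i) * weighted_norm e k (\<Prod>i\<in>I. F i)"
    using assms by (rule weighted_norm_mult)
  also have "\<dots> \<le> weighted_norm e k (F i) * (\<Prod>i\<in>I. weighted_norm e k (F i))"
    using insert.IH assms by (intro mult_left_mono weighted_norm_nonneg)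
  finally show ?case
    using insert by simp
qed simp_all

text \<open>Splitting off the first two terms leaves \<open>e\<close> times the sum shortened by
  two, hence the two-step induction; 4 is the fixed point of x = 2 + x / 2.\<close>

lemma sum_power_half_le:
  fixes e :: real
  assumes "0 \<le> e" "e \<le> 1 / 2"
  shows "(\<Sum>j\<le>k. e ^ (j div 2)) \<le> 4"
proof (induction k rule: induct_nat_012)
  case (ge2 k)
  have "(\<Sum>j\<le>Suc (Suc k). e ^ (j div 2)) = 2 + e * (\<Sum>j\<le>k. e ^ (j div 2))"
    by (simp add: sum.atMost_Suc_shift sum_distrib_left del: sum.atMost_Suc)
  also have "\<dots> \<le> 2 + (1 / 2) * 4"
    using ge2.IH(1) assms by (intro add_left_mono mult_mono sum_nonneg) auto
  finally show ?case by simp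
qed simp_all

text \<open>Since coefficient 1 vanishes, every remaining term has \<open>j \<ge> 2\<close> and
  yields a factor \<open>e\<close>.\<close>

lemma weighted_norm_le:
  assumes "0 \<le> e" "e \<le> 1 / 2" "F $ 0 = 1" "F $ 1 = 0" and "\<And>j. j \<ge> 2 \<Longrightarrow> \<bar>F $ j\<bar> \<le> b"
  shows "weighted_norm e k F \<le> 1 + 4 * b * e"
proof -
  have b: "b \<ge> 0"
    using assms(5)[of 2] by simp
  consider "k = 0" | "k = 1" | l where "k = Suc (Suc l)"
    by (metis One_nat_def not0_implies_Suc)
  then show ?thesis
  proof cases
    case (3 l)
    have "weighted_norm e k F = 1 + (\<Sum>j\<le>l. \<bar>F $ Suc (Suc j)\<bar> * (e * e ^ (j div 2)))"
      using assms(3,4) by (simp add: weighted_norm_def 3 sum.atMost_Suc_shift del: sum.atMost_Suc)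
    also have "\<dots> \<le> 1 + (\<Sum>j\<le>l. b * (e * e ^ (j div 2)))"
      using assms by (intro add_left_mono sum_mono mult_right_mono) auto
    also have "(\<Sum>j\<le>l. b * (e * e ^ (j div 2))) = b * e * (\<Sum>j\<le>l. e ^ (j div 2))"
      by (simp add: sum_distrib_left mult_ac)
    also have "1 + \<dots> \<le> 1 + b * e * 4"
      using sum_power_half_le[of e l] assms b by (intro add_left_mono mult_left_mono) auto
    finally show ?thesis by simp
  qed (use assms b in \<open>auto simp: weighted_norm_def\<close>)
qed

lemma poisson_fps_mult_approx:
  assumes "c > 0" and "real k \<le> e * c" and "F $ 0 = 1" "F $ 1 = 0"
  shows "\<bar>(F * poisson_fps c) $ k - poisson_fps c $ k\<bar>
           \<le> 2 * (weighted_norm e k F - 1) * poisson_fps c $ k"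
proof -
  let ?a = "\<lambda>j. poisson_fps c $ j"
  have split: "(\<Sum>j\<le>k. f j) = f 0 + (\<Sum>j=1..k. f j)" for f :: "nat \<Rightarrow> real"
    by (simp add: atMost_atLeast0 sum.atLeast_Suc_atMost)
  have "(F * poisson_fps c) $ k - ?a k = (\<Sum>j=1..k. F $ j * ?a (k - j))"
    using assms(3) by (simp add: fps_mult_nth split flip: atMost_atLeast0)
  also have "\<bar>\<dots>\<bar> \<le> (\<Sum>j=1..k. \<bar>F $ j\<bar> * ?a (k - j))"
    using assms(1) by (intro order_trans[OF sum_abs] sum_mono) (simp add: abs_mult poisson_fps_nonneg)
  also have "\<dots> \<le> (\<Sum>j=1..k. \<bar>F $ j\<bar> * (2 * e ^ (j div 2) * ?a k))"
  proof (rule sum_mono)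
    fix j assume j: "j \<in> {1..k}"
    show "\<bar>F $ j\<bar> * ?a (k - j) \<le> \<bar>F $ j\<bar> * (2 * e ^ (j div 2) * ?a k)"
    proof (cases "j = 1")
      case False
      then show ?thesis
        using j assms(1,2) by (intro mult_left_mono poisson_fps_nth_diff_le) auto
    qed (simp add: assms(4)[simplified])
  qed
  also have "\<dots> = 2 * (weighted_norm e k F - 1) * ?a k"
    using assms(3) by (simp add: weighted_norm_def split sum_distrib_left sum_distrib_right mult_ac)
  finally show ?thesis .
qed

section \<open>Bernoulli factors relative to Poisson factors\<close>

definition bernoulli_fps :: "real \<Rightarrow> real fps" where
  "bernoulli_fps p = fps_const (1 - p) * fps_exp (- p) + fps_const p * fps_exp (1 - p)"

text \<open>The bound comes from the derivative: the first-order terms in \<open>p\<close> cancel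
  there, leaving \<open>p\<^sup>2\<close> times a product of two series with bounded
  coefficients.\<close>

lemma bernoulli_fps_correction:
  assumes "0 \<le> p" "p \<le> 1"
  defines "F \<equiv> bernoulli_fps p * poisson_fps (- p)"
  shows "F $ 0 = 1" and "F $ 1 = 0" and "\<And>j. j \<ge> 2 \<Longrightarrow> \<bar>F $ j\<bar> \<le> 2 * p\<^sup>2"
proof -
  \<comment> \<open>The linear terms cancel in the exponent, so \<open>u\<close> is exp (- p (e^z -
    1)).\<close>
  define u where "u = fps_exp (- p) * poisson_fps (- p)"
  have u': "fps_deriv u = - (fps_const p * (u * fps_exp 1))"
    by (simp add: u_def poisson_fps_deriv algebra_simps flip: fps_const_neg)
  \<comment> \<open>By \<open>u'\<close>, \<open>Suc j\<close> times the next coefficient is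
    \<open>- p\<close> times a sum of \<open>Suc j\<close> terms of size at most 1.\<close>
  have u_le: "\<bar>u $ k\<bar> \<le> 1" for k
  proof (induction k rule: less_induct)
    case (less k)
    show ?case
    proof (cases k)
      case (Suc j)
      have "real (Suc j) * u $ Suc j = fps_deriv u $ j"
        by simp
      also have "\<dots> = - (p * (\<Sum>i\<le>j. u $ i / fact (j - i)))"
        unfolding u' by (simp add: fps_mult_nth[of u] atMost_atLeast0)
      finally have "\<bar>real (Suc j) * u $ Suc j\<bar> = \<bar>p * (\<Sum>i\<le>j. u $ i / fact (j - i))\<bar>"
        by simp
      then have "real (Suc j) * \<bar>u $ Suc j\<bar> = p * \<bar>\<Sum>i\<le>j. u $ i / fact (j - i)\<bar>"
        by (simp only: abs_mult abs_of_nat abs_of_nonneg[OF assms(1)])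
      also have "\<dots> \<le> 1 * (\<Sum>i\<le>j. 1)"
      proof (intro mult_mono order_trans[OF sum_abs] sum_mono)
        fix i assume "i \<in> {..j}"
        then have "\<bar>u $ i\<bar> \<le> 1"
          using less Suc by simp
        also have "1 \<le> (fact (j - i) :: real)"
          by (rule fact_ge_1)
        finally show "\<bar>u $ i / fact (j - i)\<bar> \<le> 1"
          by (simp add: divide_le_eq_1)
      qed (use assms in auto)
      finally show ?thesis
        using Suc by simp
    qed (simp add: u_def)
  qed
  have exp_diff: "fps_exp (1 - p) = fps_exp 1 * fps_exp (- p)"
    by (simp flip: fps_exp_add_mult)
  have exp2: "fps_exp 2 = fps_exp 1 * (fps_exp 1 :: real fps)"
    by (simp flip: fps_exp_add_mult)
  have F: "F = (1 + fps_const p * (fps_exp 1 - 1)) * u"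
    by (simp add: F_def bernoulli_fps_def u_def exp_diff algebra_simps flip: fps_const_sub)
  have F': "fps_deriv F = - (fps_const (p\<^sup>2) * (u * (fps_exp 2 - fps_exp 1)))"
    unfolding F by (simp add: u' exp2 algebra_simps power2_eq_square flip: fps_const_mult)
  show "F $ 0 = 1"
    by (simp add: F u_def)
  show "F $ 1 = 0"
    using arg_cong[OF F', of "\<lambda>f. f $ 0"] by simp
  show "\<bar>F $ j\<bar> \<le> 2 * p\<^sup>2" if "j \<ge> 2" for j
  proof -
    from that obtain l where j: "j = Suc l"
      by (cases j) auto
    let ?g = "\<lambda>i. (fps_exp 2 - fps_exp 1 :: real fps) $ i"
    \<comment> \<open>The coefficient \<open>2 ^ i / fact i - 1 / fact i\<close> lies between 0 and
      \<open>2 ^ i / fact i\<close>, which is at most 2.\<close>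
    have g: "\<bar>?g i\<bar> \<le> 2" for i
    proof -
      have "(2::real) ^ i \<le> 2 * fact i"
      proof (induction i)
        case (Suc i)
        show ?case
        proof (cases "i = 0")
          case False
          then have "2 * 2 ^ i \<le> (real (Suc i)) * (2 * fact i)"
            using Suc by (intro mult_mono) auto
          then show ?thesis
            by (simp add: algebra_simps)
        qed simp
      qed simp
      then have "2 ^ i / fact i \<le> (2::real)"
        by (simp add: divide_le_eq)
      moreover have "1 / fact i \<le> (2 ^ i / fact i :: real)"
        by (simp add: divide_right_mono)
      moreover have "0 \<le> (1 / fact i :: real)"
        by simp
      ultimately have "\<bar>2 ^ i / fact i - 1 / fact i\<bar> \<le> (2::real)"
        by linarith
      then show ?thesis by simp
    qed
    have "real (Suc l) * F $ Suc l = fps_deriv F $ l"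
      by simp
    also have "\<dots> = - (p\<^sup>2 * (\<Sum>i\<le>l. u $ i * ?g (l - i)))"
      unfolding F' by (simp add: fps_mult_nth[of u] atMost_atLeast0)
    finally have "\<bar>real (Suc l) * F $ Suc l\<bar> = \<bar>p\<^sup>2 * (\<Sum>i\<le>l. u $ i * ?g (l - i))\<bar>"
      by (simp only: abs_minus_cancel)
    then have "real (Suc l) * \<bar>F $ Suc l\<bar> = p\<^sup>2 * \<bar>\<Sum>i\<le>l. u $ i * ?g (l - i)\<bar>"
      by (simp only: abs_mult abs_of_nat abs_power2)
    \<comment> \<open>The number \<open>l + 1\<close> of convolution terms cancels the factor
      produced by differentiation.\<close>
    also have "\<dots> \<le> p\<^sup>2 * (\<Sum>i\<le>l. 1 * 2)"
      by (intro mult_left_mono order_trans[OF sum_abs] sum_mono)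
         (auto simp only: abs_mult intro!: mult_mono u_le g zero_le_power2)
    finally have "(real l + 1) * \<bar>F $ Suc l\<bar> \<le> (real l + 1) * (2 * p\<^sup>2)"
      by (simp add: algebra_simps)
    then show ?thesis
      unfolding j by (rule mult_left_le_imp_le) simp
  qed
qed

text \<open>The Poisson series splits over the summands of \<open>c\<close>, so the corrections
  multiply to a single \<open>G\<close>. The 8 is the 4 of \<open>weighted_norm_le\<close> times the
  2 of \<open>bernoulli_fps_correction\<close>.\<close>

lemma bernoulli_fps_prod_approx:
  assumes p: "\<And>i. i \<in> I \<Longrightarrow> p i \<in> {0..1}" and "finite I" and c: "c = sum p I" "c > 0"
    and e: "real k = e * c" "e \<le> 1 / 2"
  shows "\<bar>(\<Prod>i\<in>I. bernoulli_fps (p i)) $ k - poisson_fps c $ k\<bar>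
           \<le> 2 * (exp (8 * e * (\<Sum>i\<in>I. (p i)\<^sup>2)) - 1) * poisson_fps c $ k"
proof -
  define F where "F i = bernoulli_fps (p i) * poisson_fps (- p i)" for i
  define G where "G = (\<Prod>i\<in>I. F i)"
  have e0: "e \<ge> 0"
    using e(1) c(2) by (metis of_nat_0_le_iff zero_le_mult_iff not_le)
  have F: "F i $ 0 = 1" "F i $ 1 = 0" "\<And>j. j \<ge> 2 \<Longrightarrow> \<bar>F i $ j\<bar> \<le> 2 * (p i)\<^sup>2" if "i \<in> I" for i
    using bernoulli_fps_correction[of "p i"] p[OF that] unfolding F_def by auto
  have "G $ 0 = 1 \<and> G $ 1 = 0"
    unfolding G_def using \<open>finite I\<close> F(1,2) by (induction I rule: finite_induct) auto
  then have G: "G $ 0 = 1" "G $ 1 = 0" by auto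
  have "F i * poisson_fps (p i) = bernoulli_fps (p i)" for i
    by (simp add: F_def mult.assoc flip: poisson_fps_add)
  then have "(\<Prod>i\<in>I. bernoulli_fps (p i)) = G * poisson_fps c"
    by (simp add: G_def c poisson_fps_sum[OF \<open>finite I\<close>] flip: prod.distrib)
  then have "\<bar>(\<Prod>i\<in>I. bernoulli_fps (p i)) $ k - poisson_fps c $ k\<bar>
      \<le> 2 * (weighted_norm e k G - 1) * poisson_fps c $ k"
    using poisson_fps_mult_approx[OF c(2) _ G, of k e] e by simp
  also have "weighted_norm e k G \<le> exp (8 * e * (\<Sum>i\<in>I. (p i)\<^sup>2))"
  proof -
    have "weighted_norm e k G \<le> (\<Prod>i\<in>I. weighted_norm e k (F i))"
      unfolding G_def using e0 e(2) by (intro weighted_norm_prod) auto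
    also have "\<dots> \<le> (\<Prod>i\<in>I. exp (8 * e * (p i)\<^sup>2))"
    proof (intro prod_mono conjI weighted_norm_nonneg e0)
      fix i assume "i \<in> I"
      then have "weighted_norm e k (F i) \<le> 1 + 4 * (2 * (p i)\<^sup>2) * e"
        by (intro weighted_norm_le e0 e(2) F)
      also have "\<dots> \<le> exp (8 * e * (p i)\<^sup>2)"
        using exp_ge_add_one_self[of "8 * e * (p i)\<^sup>2"] by (simp add: mult_ac)
      finally show "weighted_norm e k (F i) \<le> exp (8 * e * (p i)\<^sup>2)" .
    qed
    also have "\<dots> = exp (8 * e * (\<Sum>i\<in>I. (p i)\<^sup>2))"
      using \<open>finite I\<close> by (simp add: exp_sum sum_distrib_left)
    finally show ?thesis .
  qed
  finally show ?thesis
    using c(2) by (simp add: mult_right_mono poisson_fps_nonneg)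
qed

section \<open>Moment series of sums of independent variables\<close>

text \<open>A non-integrable power would silently contribute 0, so integrability is tracked
  alongside.\<close>

definition moment_fps :: "'a measure \<Rightarrow> ('a \<Rightarrow> real) \<Rightarrow> real fps" where
  "moment_fps M Z = Abs_fps (\<lambda>k. (\<integral>\<omega>. Z \<omega> ^ k \<partial>M) / fact k)"

lemma moment_fps_nth: "moment_fps M Z $ k = (\<integral>\<omega>. Z \<omega> ^ k \<partial>M) / fact k"
  by (simp add: moment_fps_def)

text \<open>Independence factors each term of the binomial expansion, and dividing by factorials
  turns the binomial convolution into a Cauchy product.\<close>

lemma (in prob_space)
  assumes ind: "indep_var borel Z borel W"
    and Z: "\<And>k. integrable M (\<lambda>\<omega>. Z \<omega> ^ k)" and W: "\<And>k. integrable M (\<lambda>\<omega>. W \<omega> ^ k)"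
  shows integrable_power_add: "integrable M (\<lambda>\<omega>. (Z \<omega> + W \<omega>) ^ k)"
    and moment_fps_add: "moment_fps M (\<lambda>\<omega>. Z \<omega> + W \<omega>) = moment_fps M Z * moment_fps M W"
proof -
  have ind': "indep_var borel (\<lambda>\<omega>. Z \<omega> ^ i) borel (\<lambda>\<omega>. W \<omega> ^ j)" for i j
    using indep_var_compose[OF ind, of "\<lambda>x. x ^ i" borel "\<lambda>x. x ^ j" borel]
    by (simp add: comp_def)
  have int: "integrable M (\<lambda>\<omega>. real (k choose i) * (Z \<omega> ^ i * W \<omega> ^ (k - i)))" for k i
    by (intro integrable_mult_right indep_var_integrable ind' Z W)
  have expand: "(Z \<omega> + W \<omega>) ^ k = (\<Sum>i\<le>k. real (k choose i) * (Z \<omega> ^ i * W \<omega> ^ (k - i)))" for \<omega> k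
    by (simp add: binomial_ring mult.assoc)
  show "integrable M (\<lambda>\<omega>. (Z \<omega> + W \<omega>) ^ k)" for k
    unfolding expand by (intro Bochner_Integration.integrable_sum int)
  show "moment_fps M (\<lambda>\<omega>. Z \<omega> + W \<omega>) = moment_fps M Z * moment_fps M W"
  proof (rule fps_ext)
    fix k
    have "(\<integral>\<omega>. (Z \<omega> + W \<omega>) ^ k \<partial>M) =
        (\<Sum>i\<le>k. real (k choose i) * ((\<integral>\<omega>. Z \<omega> ^ i \<partial>M) * (\<integral>\<omega>. W \<omega> ^ (k - i) \<partial>M)))"
      unfolding expand
      by (subst Bochner_Integration.integral_sum)
         (simp_all add: indep_var_integrable[OF ind' Z W] indep_var_lebesgue_integral[OF ind' Z W])
    then show "moment_fps M (\<lambda>\<omega>. Z \<omega> + W \<omega>) $ k = (moment_fps M Z * moment_fps M W) $ k"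
      by (simp add: moment_fps_nth fps_mult_nth atMost_atLeast0 sum_divide_distrib binomial_fact)
  qed
qed

text \<open>Both claims go through one induction, as adding a summand requires integrable powers of
  the partial sum.\<close>

lemma (in prob_space) moment_fps_sum:
  assumes "finite I" and "indep_vars (\<lambda>_. borel) Z I"
    and "\<And>i k. i \<in> I \<Longrightarrow> integrable M (\<lambda>\<omega>. Z i \<omega> ^ k)"
  shows "(\<forall>k. integrable M (\<lambda>\<omega>. (\<Sum>i\<in>I. Z i \<omega>) ^ k)) \<and>
    moment_fps M (\<lambda>\<omega>. \<Sum>i\<in>I. Z i \<omega>) = (\<Prod>i\<in>I. moment_fps M (Z i))"
  using assms
proof (induction I rule: finite_induct)
  case empty
  have "moment_fps M (\<lambda>_. 0) = 1"
    by (rule fps_ext) (simp add: moment_fps_nth power_0_left prob_space)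
  then show ?case
    by (simp add: power_0_left)
next
  case (insert i I)
  have IH: "\<And>k. integrable M (\<lambda>\<omega>. (\<Sum>i\<in>I. Z i \<omega>) ^ k)"
    "moment_fps M (\<lambda>\<omega>. \<Sum>i\<in>I. Z i \<omega>) = (\<Prod>i\<in>I. moment_fps M (Z i))"
    using insert.IH indep_vars_subset[OF insert.prems(1)] insert.prems(2) by auto
  have ind: "indep_var borel (Z i) borel (\<lambda>\<omega>. \<Sum>i\<in>I. Z i \<omega>)"
    using insert by (intro indep_vars_sum) auto
  have "integrable M (\<lambda>\<omega>. Z i \<omega> ^ k)" for k
    by (rule insert.prems(2)) simp
  from integrable_power_add[OF ind this IH(1)] moment_fps_add[OF ind this IH(1)] show ?case
    using insert.hyps by (simp add: IH(2))
qed

section \<open>Central moments of the Poisson distribution\<close>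

lemma integrable_pmf_nat_iff:
  fixes f :: "nat \<Rightarrow> real"
  shows "integrable (measure_pmf P) f \<longleftrightarrow> summable (\<lambda>n. \<bar>pmf P n * f n\<bar>)"
  by (simp add: measure_pmf_eq_density integrable_real_density integrable_count_space_nat_iff)

lemma sums_integral_pmf_nat:
  fixes f :: "nat \<Rightarrow> real"
  assumes "integrable (measure_pmf P) f"
  shows "(\<lambda>n. pmf P n * f n) sums integral\<^sup>L (measure_pmf P) f"
  using assms sums_integral_count_space_nat[of "\<lambda>n. pmf P n * f n"]
  by (simp add: measure_pmf_eq_density integrable_real_density integral_real_density)

text \<open>The Stein-Chen identity: \<open>Suc n\<close> times the mass at \<open>Suc n\<close> is
  \<open>r\<close> times the mass at \<open>n\<close>, and the term at 0 vanishes.\<close>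

lemma poisson_pmf_size_bias:
  fixes g :: "nat \<Rightarrow> real"
  assumes r: "r > 0" and int: "integrable (poisson_pmf r) (\<lambda>n. g (Suc n))"
  shows "integrable (poisson_pmf r) (\<lambda>n. real n * g n)"
    and "(\<integral>n. real n * g n \<partial>poisson_pmf r) = r * (\<integral>n. g (Suc n) \<partial>poisson_pmf r)"
proof -
  let ?f = "\<lambda>n. pmf (poisson_pmf r) n * (real n * g n)"
  have shift: "?f (Suc n) = r * (pmf (poisson_pmf r) n * g (Suc n))" for n
    using r by (simp add: field_simps del: of_nat_Suc)
  have "summable (\<lambda>n. \<bar>?f (Suc n)\<bar>)"
    unfolding shift abs_mult[of r] using int
    by (intro summable_mult) (simp only: integrable_pmf_nat_iff)
  then show *: "integrable (poisson_pmf r) (\<lambda>n. real n * g n)"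
    unfolding integrable_pmf_nat_iff by (subst (asm) summable_Suc_iff)
  have "(\<lambda>n. ?f (Suc n)) sums (r * (\<integral>n. g (Suc n) \<partial>poisson_pmf r))"
    unfolding shift by (intro sums_mult sums_integral_pmf_nat int)
  then have "?f sums (r * (\<integral>n. g (Suc n) \<partial>poisson_pmf r))"
    by (subst (asm) sums_Suc_iff) simp
  then show "(\<integral>n. real n * g n \<partial>poisson_pmf r) = r * (\<integral>n. g (Suc n) \<partial>poisson_pmf r)"
    using sums_integral_pmf_nat[OF *] by (rule sums_unique2[symmetric])
qed

text \<open>The shift \<open>a\<close> is kept arbitrary because size biasing replaces it by
  \<open>a + 1\<close>.\<close>

lemma integrable_poisson_pmf_power:
  assumes "r > 0"
  shows "integrable (poisson_pmf r) (\<lambda>n. (real n + a) ^ k)"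
proof (induction k arbitrary: a)
  case (Suc k)
  have "integrable (poisson_pmf r) (\<lambda>n. real n * (real n + a) ^ k)"
    using Suc.IH[of "a + 1"] by (intro poisson_pmf_size_bias assms) (simp add: add_ac)
  then have "integrable (poisson_pmf r) (\<lambda>n. real n * (real n + a) ^ k + a * (real n + a) ^ k)"
    using Suc.IH[of a] by (intro Bochner_Integration.integrable_add integrable_mult_right)
  then show ?case
    by (simp add: distrib_right)
qed simp

text \<open>Size biasing applied to \<open>(real n - r) ^ k\<close> gives a recurrence for the
  moments that is the differential equation of \<open>poisson_fps r\<close>.\<close>

lemma moment_fps_poisson_pmf:
  assumes r: "r > 0"
  shows "moment_fps (poisson_pmf r) (\<lambda>n. real n - r) = poisson_fps r"
proof (rule poisson_fps_unique)
  let ?P = "measure_pmf (poisson_pmf r)"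
  let ?F = "moment_fps ?P (\<lambda>n. real n - r)"
  let ?m = "\<lambda>k. \<integral>n. (real n - r) ^ k \<partial>?P"
  have int: "integrable ?P (\<lambda>n. (real n - r) ^ k)" for k
    using integrable_poisson_pmf_power[OF r, of "- r" k] by simp
  have expand: "(real (Suc n) - r) ^ k = (\<Sum>j\<le>k. real (k choose j) * (real n - r) ^ j)" for n k
    using binomial_ring[of "real n - r" 1 k] by (simp add: algebra_simps)
  have int': "integrable ?P (\<lambda>n. (real (Suc n) - r) ^ k)" for k
    unfolding expand by (intro Bochner_Integration.integrable_sum integrable_mult_right int)
  have rec: "?m (Suc k) = r * ((\<Sum>j\<le>k. real (k choose j) * ?m j) - ?m k)" for k
  proof -
    have "?m (Suc k) = (\<integral>n. real n * (real n - r) ^ k - r * (real n - r) ^ k \<partial>?P)"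
      by (simp add: algebra_simps)
    also have "\<dots> = (\<integral>n. real n * (real n - r) ^ k \<partial>?P) - r * ?m k"
      using poisson_pmf_size_bias(1)[OF r int', of k] int[of k] by simp
    also have "(\<integral>n. real n * (real n - r) ^ k \<partial>?P) = r * (\<integral>n. (real (Suc n) - r) ^ k \<partial>?P)"
      by (intro poisson_pmf_size_bias(2) r int')
    also have "(\<integral>n. (real (Suc n) - r) ^ k \<partial>?P) = (\<Sum>j\<le>k. real (k choose j) * ?m j)"
      unfolding expand by (subst Bochner_Integration.integral_sum) (simp_all add: int)
    finally show ?thesis
      by (simp add: right_diff_distrib)
  qed
  show "fps_deriv ?F = fps_const r * (fps_exp 1 - 1) * ?F"
  proof (rule fps_ext)
    fix k
    have "fps_deriv ?F $ k = ?m (Suc k) / fact k"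
      by (simp add: moment_fps_nth field_simps del: of_nat_Suc power_Suc)
    also have "\<dots> = r * ((\<Sum>j\<le>k. ?m j / fact j * (1 / fact (k - j))) - ?m k / fact k)"
    proof -
      have "(\<Sum>j\<le>k. real (k choose j) * ?m j) = fact k * (\<Sum>j\<le>k. ?m j / fact j * (1 / fact (k - j)))"
        by (simp add: sum_distrib_left binomial_fact mult_ac)
      then show ?thesis
        unfolding rec by (simp add: field_simps)
    qed
    also have "\<dots> = (fps_const r * (?F * fps_exp 1 - ?F)) $ k"
      by (simp add: fps_mult_nth[of ?F] moment_fps_nth atMost_atLeast0)
    finally show "fps_deriv ?F $ k = (fps_const r * (fps_exp 1 - 1) * ?F) $ k"
      by (simp add: algebra_simps)
  qed
  show "?F $ 0 = 1"
    by (simp add: moment_fps_nth)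
qed

section \<open>Transfer to the random variables\<close>

lemma poisson_rv_moment:
  assumes "poisson_rv M r X" "r > 0"
  shows "(\<integral>\<omega>. (X \<omega> - r) ^ k \<partial>M) = fact k * poisson_fps r $ k"
proof -
  have X [measurable]: "X \<in> borel_measurable M"
    and distr: "distr M borel X = distr (poisson_pmf r) borel of_nat"
    using assms by (auto simp: poisson_rv_def)
  have "(\<integral>\<omega>. (X \<omega> - r) ^ k \<partial>M) = (\<integral>x. (x - r) ^ k \<partial>distr M borel X)"
    by (subst integral_distr) auto
  also have "\<dots> = (\<integral>n. (real n - r) ^ k \<partial>poisson_pmf r)"
    unfolding distr by (subst integral_distr) auto
  also have "\<dots> = fact k * poisson_fps r $ k"
    by (simp add: moment_fps_nth flip: moment_fps_poisson_pmf[OF assms(2)])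
  finally show ?thesis .
qed

lemma bernoulli_rv_moment_fps:
  assumes "bernoulli_rv M p Y" "p \<in> {0..1}"
  shows "integrable M (\<lambda>\<omega>. (Y \<omega> - p) ^ k)"
    and "moment_fps M (\<lambda>\<omega>. Y \<omega> - p) = bernoulli_fps p"
proof -
  have Y [measurable]: "Y \<in> borel_measurable M"
    and distr: "distr M borel Y = distr (bernoulli_pmf p) borel of_bool"
    using assms by (auto simp: bernoulli_rv_def)
  have "integrable (distr M borel Y) (\<lambda>x. (x - p) ^ k)"
    unfolding distr by (subst integrable_distr_eq) (auto intro: integrable_measure_pmf_finite)
  then show "integrable M (\<lambda>\<omega>. (Y \<omega> - p) ^ k)"
    by (subst (asm) integrable_distr_eq) auto
  show "moment_fps M (\<lambda>\<omega>. Y \<omega> - p) = bernoulli_fps p"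
  proof (rule fps_ext)
    fix k
    have "(\<integral>\<omega>. (Y \<omega> - p) ^ k \<partial>M) = (\<integral>x. (x - p) ^ k \<partial>distr M borel Y)"
      by (subst integral_distr) auto
    also have "\<dots> = (\<integral>b. (of_bool b - p) ^ k \<partial>bernoulli_pmf p)"
      unfolding distr by (subst integral_distr) auto
    also have "\<dots> = p * (1 - p) ^ k + (1 - p) * (- p) ^ k"
      using assms(2) by simp
    finally show "moment_fps M (\<lambda>\<omega>. Y \<omega> - p) $ k = bernoulli_fps p $ k"
      by (simp add: moment_fps_nth bernoulli_fps_def add_divide_distrib)
  qed
qed

lemma bernoulli_sum_moment:
  assumes "prob_space M" and "finite I" and p: "\<And>i. i \<in> I \<Longrightarrow> p i \<in> {0..1}"
    and Y: "\<And>i. i \<in> I \<Longrightarrow> bernoulli_rv M (p i) (Y i)"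
    and indep: "prob_space.indep_vars M (\<lambda>_. borel) Y I"
  shows "(\<integral>\<omega>. ((\<Sum>i\<in>I. Y i \<omega>) - sum p I) ^ k \<partial>M) = fact k * (\<Prod>i\<in>I. bernoulli_fps (p i)) $ k"
proof -
  interpret prob_space M by fact
  have "indep_vars (\<lambda>_. borel) (\<lambda>i \<omega>. Y i \<omega> - p i) I"
    using indep by (rule indep_vars_compose2) auto
  then have "moment_fps M (\<lambda>\<omega>. \<Sum>i\<in>I. Y i \<omega> - p i) = (\<Prod>i\<in>I. moment_fps M (\<lambda>\<omega>. Y i \<omega> - p i))"
    using moment_fps_sum[OF \<open>finite I\<close>] bernoulli_rv_moment_fps(1)[OF Y p] by blast
  also have "\<dots> = (\<Prod>i\<in>I. bernoulli_fps (p i))"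
    by (intro prod.cong refl bernoulli_rv_moment_fps(2) Y p)
  finally have "moment_fps M (\<lambda>\<omega>. \<Sum>i\<in>I. Y i \<omega> - p i) $ k = (\<Prod>i\<in>I. bernoulli_fps (p i)) $ k"
    by simp
  then show ?thesis
    by (simp add: moment_fps_nth sum_subtractf field_simps)
qed

section \<open>Passage to the limit\<close>

theorem theorem1p4:
  fixes n :: "nat \<Rightarrow> nat"
    and p :: "nat \<Rightarrow> nat \<Rightarrow> real"
    and k :: "nat \<Rightarrow> nat"
    and M :: "nat \<Rightarrow> 'a measure"
    and Y :: "nat \<Rightarrow> nat \<Rightarrow> 'a \<Rightarrow> real"
    and N :: "nat \<Rightarrow> 'b measure"
    and X :: "nat \<Rightarrow> 'b \<Rightarrow> real"
    and lam :: "nat \<Rightarrow> real"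
  assumes p: "\<And>m i. i \<in> {1..n m} \<Longrightarrow> p m i \<in> {0..1}"
    and M: "\<And>m. prob_space (M m)"
    and Y_bernoulli: "\<And>m i. i \<in> {1..n m} \<Longrightarrow> bernoulli_rv (M m) (p m i) (Y m i)"
    and Y_indep: "\<And>m. prob_space.indep_vars (M m) (\<lambda>_. borel) (Y m) {1..n m}"
    and lam: "\<And>m. lam m = (\<Sum>i = 1..n m. p m i)"
    and N: "\<And>m. prob_space (N m)"
    and X_poisson: "\<And>m. poisson_rv (N m) (lam m) (X m)"
    and k_ge_2: "\<And>m. k m \<ge> 2"
    and k_small: "(\<lambda>m. real (k m)) \<in> o(\<lambda>m. lam m / max 1 (\<Sum>i = 1..n m. (p m i)\<^sup>2))"
  shows "(\<lambda>m. prob_space.expectation (M m) (\<lambda>\<omega>. ((\<Sum>i = 1..n m. Y m i \<omega>) - lam m) ^ k m) /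
              prob_space.expectation (N m) (\<lambda>\<omega>. (X m \<omega> - lam m) ^ k m)) \<longlonglongrightarrow> 1"
proof -
  define S where "S m = (\<Sum>i = 1..n m. (p m i)\<^sup>2)" for m
  define e where "e m = real (k m) / lam m" for m
  define d where "d m = real (k m) / (lam m / max 1 (S m))" for m
  let ?ratio = "\<lambda>m. (\<integral>\<omega>. ((\<Sum>i = 1..n m. Y m i \<omega>) - lam m) ^ k m \<partial>M m) /
                     (\<integral>\<omega>. (X m \<omega> - lam m) ^ k m \<partial>N m)"
  have d: "d \<longlonglongrightarrow> 0"
    using smalloD_tendsto[OF k_small] unfolding d_def S_def .
  \<comment> \<open>If \<open>lam m = 0\<close>, the comparison function is 0 at \<open>m\<close>,
    while \<open>k m \<ge> 2\<close>; so this can happen only before the little-o bound with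
    constant 1 takes effect.\<close>
  have pos: "eventually (\<lambda>m. lam m > 0) sequentially"
    using landau_o.smallD[OF k_small zero_less_one]
  proof eventually_elim
    case (elim m)
    have "lam m \<noteq> 0"
      using elim k_ge_2[of m] by auto
    moreover have "lam m \<ge> 0"
      unfolding lam using p by (intro sum_nonneg) auto
    ultimately show ?case by simp
  qed
  have small: "eventually (\<lambda>m. d m < 1 / 2) sequentially"
    using order_tendstoD(2)[OF d, of "1 / 2"] by simp
  have bound: "eventually (\<lambda>m. norm (?ratio m - 1) \<le> 2 * (exp (8 * d m) - 1)) sequentially"
    using pos small
  proof eventually_elim
    case (elim m)
    let ?b = "(\<Prod>i\<in>{1..n m}. bernoulli_fps (p m i)) $ k m" and ?a = "poisson_fps (lam m) $ k m"
    have a: "?a > 0"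
      using elim(1) k_ge_2 by (rule poisson_fps_pos)
    have d_eq: "d m = e m * max 1 (S m)"
      by (simp add: d_def e_def)
    have e0: "e m \<ge> 0"
      using elim(1) by (simp add: e_def)
    \<comment> \<open>The maximum serves twice: its bound 1 makes \<open>e m\<close> small, and its
      bound \<open>S m\<close> controls the exponent.\<close>
    have e: "e m \<le> d m" "e m * S m \<le> d m"
      unfolding d_eq using mult_left_mono[OF _ e0, of 1 "max 1 (S m)"] e0
      by (auto intro: mult_left_mono)
    have ratio: "?ratio m = ?b / ?a"
      using bernoulli_sum_moment[OF M finite_atLeastAtMost p Y_bernoulli Y_indep, of m "k m", folded lam]
        poisson_rv_moment[OF X_poisson elim(1), of "k m"]
      by simp
    have "\<bar>?b - ?a\<bar> \<le> 2 * (exp (8 * e m * S m) - 1) * ?a"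
      unfolding S_def
    proof (rule bernoulli_fps_prod_approx[OF p finite_atLeastAtMost lam elim(1)])
      show "real (k m) = e m * lam m"
        using elim(1) by (simp add: e_def)
      show "e m \<le> 1 / 2"
        using e(1) elim(2) by simp
    qed
    also have "\<dots> \<le> 2 * (exp (8 * d m) - 1) * ?a"
      using e(2) a by (intro mult_right_mono) auto
    finally show ?case
      using a unfolding ratio by (simp add: diff_divide_distrib[symmetric] divide_le_eq field_simps abs_le_iff)
  qed
  have "(\<lambda>m. 2 * (exp (8 * d m) - 1)) \<longlonglongrightarrow> 2 * (exp (8 * 0) - 1)"
    by (intro tendsto_intros d)
  then have "(\<lambda>m. 2 * (exp (8 * d m) - 1)) \<longlonglongrightarrow> 0"
    by simp
  then have "(\<lambda>m. ?ratio m - 1) \<longlonglongrightarrow> 0"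
    by (rule Lim_null_comparison[OF bound])
  then show ?thesis
    by (simp only: LIM_zero_iff)
qed

end
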